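(* Suppose that $\Gamma$ is a finite set of s-formulas such that there is no closed tableau for $\Gamma$. Then there is a frame that satisfies $\Gamma$.
   Context: Fix an infinite (possibly uncountable) set $\Sigma$ of propositional variables. Propositional formulas are built from $\Sigma$ using $\lnot$, $\land$, $\lor$, $\to$. An s-formula is an expression of the form $A \prec B$ (a strict implication) or $A \not\prec B$ (a strict nonimplication), where $A$ and $B$ are propositional formulas; $\prec$ and $\not\prec$ are two formal symbols, not nested. A valuation is a function $w:\Sigma\to\{T,F\}$, extended in the usual way to all propositional formulas. A frame is a nonempty set of valuations. A frame $R$ satisfies $A \prec B$ if for every $w\in R$, $w(A)=F$ or $w(B)=T$. A frame $R$ satisfies $A\not\prec B$ if there is some $w\in R$ with $w(A)=T$ and $w(B)=F$. A frame satisfies a set of s-formulas if it satisfies every member. Fix an infinite set $W$ of world variables. A tableau formula is either an s-formula or an expression $(A,w)$ with $A$ a propositional formula and $w\in W$. A tableau for a set $\Gamma$ of tableau formulas is a finite tree whose nodes are labeled by (possibly infinite) sets of tableau formulas, whose root is labeled $\Gamma$, and in which the children of each non-leaf node are obtained from that node by one of the following rules. Below, $\Delta$ is any set of tableau formulas, "$\Delta,\varphi$" means $\Delta\cup\{\varphi\}$ ($\Delta$ may itself contain $\varphi$), the label of the parent is on the left of $\Rightarrow$ and the labels of its one or two children (separated by $\mid$) are on the right: - ($\lor$) $\Delta,(A\lor B,w)\Rightarrow \Delta,(A,w)\mid \Delta,(B,w)$ - ($\lnot\lor$) $\Delta,(\lnot(A\lor B),w)\Rightarrow \Delta,(\lnot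 A,w),(\lnot B,w)$ - ($\land$) $\Delta,(A\land B,w)\Rightarrow \Delta,(A,w),(B,w)$ - ($\lnot\land$) $\Delta,(\lnot(A\land B),w)\Rightarrow \Delta,(\lnot A,w)\mid \Delta,(\lnot B,w)$ - ($\to$) $\Delta,(A\to B,w)\Rightarrow \Delta,(\lnot A,w)\mid\Delta,(B,w)$ - ($\lnot\to$) $\Delta,(\lnot(A\to B),w)\Rightarrow\Delta,(A,w),(\lnot B,w)$ - ($\prec$) $\Delta, A\prec B\Rightarrow \Delta,(\lnot A,w)\mid\Delta,(B,w)$, for any $w\in W$ - ($\not\prec$) $\Delta, A\not\prec B\Rightarrow \Delta,(A,v),(\lnot B,v)$, where $v\in W$ is new: it is not mentioned in the label of the node where the rule is applied or of any of its ancestors - ($C$) $\Delta\Rightarrow \Delta,(A,w)\mid\Delta,(\lnot A,w)$, for any propositional formula $A$ and $w\in W$ - ($\lnot\lnot$) $\Delta,(\lnot\lnot A,w)\Rightarrow\Delta,(A,w)$. A branch is closed if it contains a node whose label contains both $(A,w)$ and $(\lnot A,w)$ for some propositional formula $A$ and some $w\in W$. A tableau is closed if every maximal branch is closed. *)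

theory Defs
  imports Main
begin

datatype 'a form =
    Var 'a
  | Neg "'a form"
  | Conj "'a form" "'a form"
  | Disj "'a form" "'a form"
  | Imp "'a form" "'a form"

datatype 'a sform =
    StrictImp "'a form" "'a form"
  | StrictNonimp "'a form" "'a form"

type_synonym 'a valuation = "'a \<Rightarrow> bool"

primrec eval :: "'a valuation \<Rightarrow> 'a form \<Rightarrow> bool" where
  "eval w (Var p) = w p"
| "eval w (Neg A) = (\<not> eval w A)"
| "eval w (Conj A B) = (eval w A \<and> eval w B)"
| "eval w (Disj A B) = (eval w A \<or> eval w B)"
| "eval w (Imp A B) = (eval w A \<longrightarrow> eval w B)"

definition frame :: "'a valuation set \<Rightarrow> bool" where
  "frame R \<longleftrightarrow> R \<noteq> {}"

primrec satisfies :: "'a valuation set \<Rightarrow> 'a sform \<Rightarrow> bool" where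
  "satisfies R (StrictImp A B) \<longleftrightarrow> (\<forall>w\<in>R. \<not> eval w A \<or> eval w B)"
| "satisfies R (StrictNonimp A B) \<longleftrightarrow> (\<exists>w\<in>R. eval w A \<and> \<not> eval w B)"

definition satisfies_set :: "'a valuation set \<Rightarrow> 'a sform set \<Rightarrow> bool" where
  "satisfies_set R \<Gamma> \<longleftrightarrow> (\<forall>\<phi>\<in>\<Gamma>. satisfies R \<phi>)"

datatype ('a, 'w) tform =
    Strict "'a sform"
  | At "'a form" 'w

type_synonym ('a, 'w) label = "('a, 'w) tform set"

definition mentioned :: "'w \<Rightarrow> ('a, 'w) label \<Rightarrow> bool" where
  "mentioned w L \<longleftrightarrow> (\<exists>A. At A w \<in> L)"

text \<open>
  \<open>tableau_rule P L Ls\<close>: a node labelled \<open>L\<close>, whose proper ancestors carry the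
  labels in \<open>P\<close>, may be given children labelled \<open>Ls\<close>. Since \<open>\<Delta>\<close> may or may not
  contain the principal formula, every rule application is free to keep or to drop
  that formula.
\<close>

inductive tableau_rule ::
  "('a, 'w) label set \<Rightarrow> ('a, 'w) label \<Rightarrow> ('a, 'w) label list \<Rightarrow> bool"
  for P :: "('a, 'w) label set" where
  disj: "tableau_rule P (insert (At (Disj A B) w) \<Delta>)
    [insert (At A w) \<Delta>, insert (At B w) \<Delta>]"
| neg_disj: "tableau_rule P (insert (At (Neg (Disj A B)) w) \<Delta>)
    [insert (At (Neg A) w) (insert (At (Neg B) w) \<Delta>)]"
| conj: "tableau_rule P (insert (At (Conj A B) w) \<Delta>)
    [insert (At A w) (insert (At B w) \<Delta>)]"
| neg_conj: "tableau_rule P (insert (At (Neg (Conj A B)) w) \<Delta>)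
    [insert (At (Neg A) w) \<Delta>, insert (At (Neg B) w) \<Delta>]"
| imp: "tableau_rule P (insert (At (Imp A B) w) \<Delta>)
    [insert (At (Neg A) w) \<Delta>, insert (At B w) \<Delta>]"
| neg_imp: "tableau_rule P (insert (At (Neg (Imp A B)) w) \<Delta>)
    [insert (At A w) (insert (At (Neg B) w) \<Delta>)]"
| strict_imp: "tableau_rule P (insert (Strict (StrictImp A B)) \<Delta>)
    [insert (At (Neg A) w) \<Delta>, insert (At B w) \<Delta>]"
| strict_nonimp: "tableau_rule P (insert (Strict (StrictNonimp A B)) \<Delta>)
    [insert (At A v) (insert (At (Neg B) v) \<Delta>)]"
  if "\<not> mentioned v (insert (Strict (StrictNonimp A B)) \<Delta>)"
    and "\<forall>L\<in>P. \<not> mentioned v L"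
| cut: "tableau_rule P \<Delta> [insert (At A w) \<Delta>, insert (At (Neg A) w) \<Delta>]"
| neg_neg: "tableau_rule P (insert (At (Neg (Neg A)) w) \<Delta>) [insert (At A w) \<Delta>]"

datatype ('a, 'w) tree =
  Node (root_label: "('a, 'w) label") (children: "('a, 'w) tree list")

text \<open>\<open>well_formed P t\<close>: \<open>t\<close> is a subtree hanging below nodes with labels \<open>P\<close>.\<close>

inductive well_formed :: "('a, 'w) label set \<Rightarrow> ('a, 'w) tree \<Rightarrow> bool" where
  leaf: "well_formed P (Node L [])"
| step: "well_formed P (Node L ts)"
  if "tableau_rule P L (map root_label ts)"
    and "\<forall>t\<in>set ts. well_formed (insert L P) t"

definition tableau :: "('a, 'w) label \<Rightarrow> ('a, 'w) tree \<Rightarrow> bool" where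
  "tableau \<Gamma> t \<longleftrightarrow> root_label t = \<Gamma> \<and> well_formed {} t"

text \<open>A maximal branch is given by the labels met on a path from the root to a leaf.\<close>

inductive maximal_branch :: "('a, 'w) tree \<Rightarrow> ('a, 'w) label list \<Rightarrow> bool" where
  leaf: "maximal_branch (Node L []) [L]"
| step: "maximal_branch (Node L ts) (L # b)"
  if "t \<in> set ts" and "maximal_branch t b"

definition closed_branch :: "('a, 'w) label list \<Rightarrow> bool" where
  "closed_branch b \<longleftrightarrow> (\<exists>L\<in>set b. \<exists>A w. At A w \<in> L \<and> At (Neg A) w \<in> L)"

definition closed_tableau :: "('a, 'w) label \<Rightarrow> ('a, 'w) tree \<Rightarrow> bool" where
  "closed_tableau \<Gamma> t \<longleftrightarrow>
    tableau \<Gamma> t \<and> (\<forall>b. maximal_branch t b \<longrightarrow> closed_branch b)"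

end

theory Submission imports Defs begin

text \<open>
  Only finitely much of a maximal consistent extension is needed. Starting from an unclosable
  label, introduce a witness world for every strict nonimplication in \<open>\<Gamma>\<close>, and then cut on every
  subformula of \<open>\<Gamma>\<close> at each of the finitely many worlds that occur (and at one arbitrary world,
  so that the frame is nonempty). In an unclosable label that decides all these formulas, each
  decomposition rule has a consistent child, so membership obeys the truth tables, and the
  worlds read as valuations form the required frame.
\<close>

text \<open>The ancestor labels \<open>P\<close> are a parameter because the freshness condition
  looks at them; only the branches starting at \<open>L\<close> itself are required to close. For
  empty \<open>P\<close> this is the existence of a closed tableau.\<close>

definition closable :: "('a, 'w) label set \<Rightarrow> ('a, 'w) label \<Rightarrow> bool" where
  "closable P L \<longleftrightarrow> (\<exists>t. root_label t = L \<and> well_formed P t \<and>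
    (\<forall>b. maximal_branch t b \<longrightarrow> closed_branch b))"

lemma maximal_branch_Node_Nil: "maximal_branch (Node L []) b \<Longrightarrow> b = [L]"
  by (erule maximal_branch.cases) auto

lemma closable_contradictory:
  assumes "At A w \<in> L" "At (Neg A) w \<in> L"
  shows "closable P L"
  unfolding closable_def
proof (intro exI[of _ "Node L []"] conjI allI impI)
  show "closed_branch b" if "maximal_branch (Node L []) b" for b
    using maximal_branch_Node_Nil[OF that] assms by (auto simp: closed_branch_def)
qed (simp_all add: well_formed.leaf)

text \<open>Closing trees for the children are grafted below a new root \<open>L\<close>; every
  maximal branch then continues as a maximal branch of one of them.\<close>

lemma closable_rule:
  assumes rule: "tableau_rule P L Ls"
    and children: "\<forall>L'\<in>set Ls. closable (insert L P) L'"
  shows "closable P L"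
proof -
  \<comment> \<open>Without children the new root would be a leaf, whose branch \<open>[L]\<close>
    may be open.\<close>
  have "Ls \<noteq> []"
    using rule by (auto elim: tableau_rule.cases)
  obtain f where f: "\<forall>L'\<in>set Ls. root_label (f L') = L' \<and> well_formed (insert L P) (f L') \<and>
      (\<forall>b. maximal_branch (f L') b \<longrightarrow> closed_branch b)"
    using bchoice[OF children[unfolded closable_def]] by (rule exE)
  have labels: "map root_label (map f Ls) = Ls"
    using f by (simp add: map_idI)
  have "well_formed P (Node L (map f Ls))"
    by (rule well_formed.step) (use rule f labels in auto)
  moreover have "closed_branch b" if "maximal_branch (Node L (map f Ls)) b" for b
    using that
  proof cases
    case leaf
    with \<open>Ls \<noteq> []\<close> show ?thesis by simp
  next
    case (step t b')
    then have "closed_branch b'"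
      using f by auto
    then show ?thesis
      using step by (auto simp: closed_branch_def)
  qed
  ultimately show ?thesis
    unfolding closable_def by (intro exI[of _ "Node L (map f Ls)"]) simp
qed

text \<open>The step by which open labels are extended: apply a rule and follow a child that still
  cannot be closed.\<close>

lemma unclosable_child:
  assumes "\<not> closable P L" "tableau_rule P L Ls"
  obtains L' where "L' \<in> set Ls" "\<not> closable (insert L P) L'"
proof (rule ccontr)
  assume "\<not> thesis"
  with that have "\<forall>L'\<in>set Ls. closable (insert L P) L'" by blast
  from closable_rule[OF assms(2) this] assms(1) show False by contradiction
qed

lemma unclosable_consistent:
  assumes "\<not> closable P L"
  shows "\<not> (At A w \<in> L \<and> At (Neg A) w \<in> L)"
  using assms closable_contradictory[of A w L P] by blast

definition decided :: "('a, 'w) label \<Rightarrow> 'a form \<Rightarrow> 'w \<Rightarrow> bool" where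
  "decided L A w \<longleftrightarrow> At A w \<in> L \<or> At (Neg A) w \<in> L"

text \<open>One cut per pair in \<open>S\<close>. A cut keeps the whole label, so earlier decisions
  persist.\<close>

lemma unclosable_decide:
  assumes "finite S" "\<not> closable P L"
  shows "\<exists>P' L'. \<not> closable P' L' \<and> L \<subseteq> L' \<and> (\<forall>(A, w)\<in>S. decided L' A w)"
  using assms
proof (induction S)
  case empty
  then show ?case by auto
next
  case (insert x S)
  obtain A w where x: "x = (A, w)" by fastforce
  from insert obtain P' L' where L': "\<not> closable P' L'" "L \<subseteq> L'"
    "\<forall>(A, w)\<in>S. decided L' A w" by blast
  from L'(1) tableau_rule.cut[of P' L' A w] obtain L''
    where "L'' \<in> set [insert (At A w) L', insert (At (Neg A) w) L']"
      and open': "\<not> closable (insert L' P') L''"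
    by (rule unclosable_child)
  then have "L' \<subseteq> L''" "decided L'' A w"
    by (auto simp: decided_def)
  then show ?case
    using open' L'(2,3) x by (intro exI[of _ "insert L' P'"] exI[of _ L'']) (auto simp: decided_def)
qed

lemma finite_mentioned:
  assumes "finite L"
  shows "finite {w. mentioned w L}"
proof (rule finite_subset)
  \<comment> \<open>The \<open>case\<close> is unspecified on \<open>Strict\<close> formulas, so the
    image may contain an extra world; inclusion is enough.\<close>
  show "{w. mentioned w L} \<subseteq> (\<lambda>\<phi>. case \<phi> of At A w \<Rightarrow> w) ` L"
    by (force simp: mentioned_def image_iff)
qed (use assms in simp)

text \<open>Finiteness of \<open>P\<close> and \<open>L\<close> is part of the invariant so that a fresh world always exists.\<close>

lemma unclosable_witnesses:
  fixes P :: "('a, 'w) label set"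
  assumes inf: "infinite (UNIV :: 'w set)" and "finite N"
    and "\<not> closable P L" "finite P" "finite L" "\<forall>K\<in>P. finite K"
    and "\<forall>(A, B)\<in>N. Strict (StrictNonimp A B) \<in> L"
  shows "\<exists>P' L'. \<not> closable P' L' \<and> finite P' \<and> finite L' \<and> (\<forall>K\<in>P'. finite K) \<and> L \<subseteq> L' \<and>
    (\<forall>(A, B)\<in>N. \<exists>v. At A v \<in> L' \<and> At (Neg B) v \<in> L')"
  using assms(2-)
proof (induction N)
  case empty
  then show ?case by auto
next
  case (insert x N)
  obtain A B where x: "x = (A, B)" by fastforce
  have "\<forall>(A, B)\<in>N. Strict (StrictNonimp A B) \<in> L"
    using insert.prems(5) by simp
  from insert.IH[OF insert.prems(1-4) this] obtain P' L'
    where L': "\<not> closable P' L'" "finite P'" "finite L'"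
    "\<forall>K\<in>P'. finite K" "L \<subseteq> L'"
    "\<forall>(A, B)\<in>N. \<exists>v. At A v \<in> L' \<and> At (Neg B) v \<in> L'" by (elim exE conjE)
  have principal: "Strict (StrictNonimp A B) \<in> L'"
    using insert.prems x L'(5) by auto
  have "finite (\<Union>K\<in>insert L' P'. {w. mentioned w K})"
    using L' by (auto intro: finite_mentioned)
  then obtain v where v: "v \<notin> (\<Union>K\<in>insert L' P'. {w. mentioned w K})"
    using ex_new_if_finite inf by blast
  let ?L = "insert (At A v) (insert (At (Neg B) v) L')"
  \<comment> \<open>The rule is applied with \<Delta> equal to \<open>L'\<close>, which keeps the
    principal formula, so the label only grows.\<close>
  have "tableau_rule P' L' [?L]"
    using tableau_rule.strict_nonimp[of v A B L' P'] v insert_absorb[OF principal] by auto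
  then have "\<not> closable (insert L' P') ?L"
    using L'(1) unclosable_child by force
  moreover have "\<forall>(A, B)\<in>insert x N. \<exists>v. At A v \<in> ?L \<and> At (Neg B) v \<in> ?L"
    using L'(6) x by auto
  moreover have "finite (insert L' P')" "finite ?L" "\<forall>K\<in>insert L' P'. finite K" "L \<subseteq> ?L"
    using L' by auto
  ultimately show ?case
    by (intro exI[of _ "insert L' P'"] exI[of _ ?L] conjI)
qed

primrec subformulas :: "'a form \<Rightarrow> 'a form set" where
  "subformulas (Var p) = {Var p}"
| "subformulas (Neg A) = insert (Neg A) (subformulas A)"
| "subformulas (Conj A B) = insert (Conj A B) (subformulas A \<union> subformulas B)"
| "subformulas (Disj A B) = insert (Disj A B) (subformulas A \<union> subformulas B)"
| "subformulas (Imp A B) = insert (Imp A B) (subformulas A \<union> subformulas B)"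

lemma finite_subformulas: "finite (subformulas A)"
  by (induction A) auto

lemma self_in_subformulas: "A \<in> subformulas A"
  by (cases A) auto

text \<open>Induction on \<open>A\<close>. A rule applied to \<open>L\<close> with the principal
  formula kept has an unclosable, hence consistent, child containing \<open>L\<close>, so what that
  child adds cannot clash with \<open>L\<close>. As the subformulas are decided at \<open>w\<close>,
  the absence of a clash becomes membership in \<open>L\<close> itself.\<close>

lemma unclosable_truth:
  assumes unclosable: "\<not> closable P L"
  shows "\<forall>C\<in>subformulas A. decided L C w \<Longrightarrow>
    eval (\<lambda>p. At (Var p) w \<in> L) A \<longleftrightarrow> At A w \<in> L"
proof -
  \<comment> \<open>\<open>F\<close> will consist of the two immediate subformulas, whose
    consistency in the child is all that the cases below use.\<close>
  have child: "\<exists>L'\<in>set Ls. \<forall>C\<in>F. \<not> (At C w \<in> L' \<and> At (Neg C) w \<in> L')"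
    if rule: "tableau_rule P L Ls" for Ls F
  proof -
    from unclosable rule obtain L' where "L' \<in> set Ls" "\<not> closable (insert L P) L'"
      by (rule unclosable_child)
    then show ?thesis
      using unclosable_consistent[of "insert L P" L'] by blast
  qed
  have neg_iff: "At (Neg C) w \<in> L \<longleftrightarrow> At C w \<notin> L" if "decided L C w" for C
    using that unclosable_consistent[OF unclosable] unfolding decided_def by blast
  show "\<forall>C\<in>subformulas A. decided L C w \<Longrightarrow> ?thesis"
  proof (induction A)
    case (Var p)
    then show ?case by simp
  next
    case (Neg A)
    then have "decided L A w"
      using self_in_subformulas by auto
    then show ?case
      using Neg neg_iff by auto
  next
    case (Conj A B)
    then have d: "decided L A w" "decided L B w" "decided L (Conj A B) w"
      using self_in_subformulas by auto
    \<comment> \<open>The only child contains both conjuncts, so neither negation is in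
      \<open>L\<close> at \<open>w\<close>; decidedness yields the conjuncts.\<close>
    have "At A w \<in> L \<and> At B w \<in> L" if "At (Conj A B) w \<in> L"
      using child[OF tableau_rule.conj[of P A B w L, unfolded insert_absorb[OF that]], of "{A, B}"]
        neg_iff[OF d(1)] neg_iff[OF d(2)] by auto
    \<comment> \<open>Each child adds the negation of one conjunct; the consistent child excludes
      that conjunct from \<open>L\<close>. \<open>Disj\<close> and \<open>Imp\<close> follow the
      same pattern.\<close>
    moreover have "At A w \<notin> L \<or> At B w \<notin> L" if "At (Neg (Conj A B)) w \<in> L"
      using child[OF tableau_rule.neg_conj[of P A B w L, unfolded insert_absorb[OF that]], of "{A, B}"]
      by auto
    ultimately show ?case
      using Conj neg_iff[OF d(3)] by auto
  next
    case (Disj A B)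
    then have d: "decided L A w" "decided L B w" "decided L (Disj A B) w"
      using self_in_subformulas by auto
    have "At A w \<in> L \<or> At B w \<in> L" if "At (Disj A B) w \<in> L"
      using child[OF tableau_rule.disj[of P A B w L, unfolded insert_absorb[OF that]], of "{A, B}"]
        neg_iff[OF d(1)] neg_iff[OF d(2)] by auto
    moreover have "At A w \<notin> L \<and> At B w \<notin> L" if "At (Neg (Disj A B)) w \<in> L"
      using child[OF tableau_rule.neg_disj[of P A B w L, unfolded insert_absorb[OF that]], of "{A, B}"]
      by auto
    ultimately show ?case
      using Disj neg_iff[OF d(3)] by auto
  next
    case (Imp A B)
    then have d: "decided L A w" "decided L B w" "decided L (Imp A B) w"
      using self_in_subformulas by auto
    have "At A w \<notin> L \<or> At B w \<in> L" if "At (Imp A B) w \<in> L"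
      using child[OF tableau_rule.imp[of P A B w L, unfolded insert_absorb[OF that]], of "{A, B}"]
        neg_iff[OF d(2)] by auto
    moreover have "At A w \<in> L \<and> At B w \<notin> L" if "At (Neg (Imp A B)) w \<in> L"
      using child[OF tableau_rule.neg_imp[of P A B w L, unfolded insert_absorb[OF that]], of "{A, B}"]
        neg_iff[OF d(1)] by auto
    ultimately show ?case
      using Imp neg_iff[OF d(3)] by auto
  qed
qed

primrec sform_subformulas :: "'a sform \<Rightarrow> 'a form set" where
  "sform_subformulas (StrictImp A B) = subformulas A \<union> subformulas B"
| "sform_subformulas (StrictNonimp A B) = subformulas A \<union> subformulas B"

lemma finite_sform_subformulas: "finite (sform_subformulas \<phi>)"
  by (cases \<phi>) (auto simp: finite_subformulas)

theorem theorem9: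
  fixes \<Gamma> :: "'a sform set"
  assumes "infinite (UNIV :: 'a set)"
    and "infinite (UNIV :: 'w set)"
    and "finite \<Gamma>"
    and "\<not> (\<exists>t :: ('a, 'w) tree. closed_tableau (Strict ` \<Gamma>) t)"
  shows "\<exists>R :: 'a valuation set. frame R \<and> satisfies_set R \<Gamma>"
proof -
  define N where "N = {(A, B). StrictNonimp A B \<in> \<Gamma>}"
  define S where "S = \<Union> (sform_subformulas ` \<Gamma>)"
  have "finite S"
    using assms(3) by (auto simp: S_def finite_sform_subformulas)
  have "finite N"
  proof (rule finite_imageD)
    show "finite ((\<lambda>(A, B). StrictNonimp A B) ` N)"
      by (rule finite_subset[OF _ assms(3)]) (auto simp: N_def)
    show "inj_on (\<lambda>(A, B). StrictNonimp A B) N"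
      by (auto simp: inj_on_def)
  qed
  have unclosable: "\<not> closable {} (Strict ` \<Gamma> :: ('a, 'w) label)"
    using assms(4) by (auto simp: closable_def closed_tableau_def tableau_def)
  have "\<forall>(A, B)\<in>N. Strict (StrictNonimp A B) \<in> (Strict ` \<Gamma> :: ('a, 'w) label)"
    by (auto simp: N_def)
  from unclosable_witnesses[OF assms(2) \<open>finite N\<close> unclosable _ _ _ this] assms(3)
  obtain P\<^sub>1 and L\<^sub>1 :: "('a, 'w) label" where L\<^sub>1: "\<not> closable P\<^sub>1 L\<^sub>1" "finite L\<^sub>1"
    "Strict ` \<Gamma> \<subseteq> L\<^sub>1" "\<forall>(A, B)\<in>N. \<exists>v. At A v \<in> L\<^sub>1 \<and> At (Neg B) v \<in> L\<^sub>1" by auto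
  \<comment> \<open>The worlds are fixed before any cut, so only finitely many decisions remain;
    \<open>undefined\<close> supplies a world even if \<open>L\<^sub>1\<close> mentions
    none.\<close>
  define W where "W = insert undefined {w. mentioned w L\<^sub>1}"
  have "finite (S \<times> W)"
    using \<open>finite S\<close> finite_mentioned[OF L\<^sub>1(2)] by (simp add: W_def)
  from unclosable_decide[OF this L\<^sub>1(1)] obtain P\<^sub>2 L\<^sub>2
    where L\<^sub>2: "\<not> closable P\<^sub>2 L\<^sub>2" "L\<^sub>1 \<subseteq> L\<^sub>2" "\<forall>(A, w)\<in>S \<times> W. decided L\<^sub>2 A w" by blast
  let ?v = "\<lambda>w p. At (Var p) w \<in> L\<^sub>2"
  have truth: "eval (?v w) A \<longleftrightarrow> At A w \<in> L\<^sub>2" if "subformulas A \<subseteq> S" "w \<in> W" for A w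
    by (rule unclosable_truth[OF L\<^sub>2(1)]) (use that L\<^sub>2(3) in auto)
  have "satisfies (?v ` W) \<phi>" if "\<phi> \<in> \<Gamma>" for \<phi>
  proof (cases \<phi>)
    case (StrictImp A B)
    have sub: "subformulas A \<subseteq> S" "subformulas B \<subseteq> S"
      using that StrictImp by (force simp: S_def)+
    have principal: "Strict (StrictImp A B) \<in> L\<^sub>2"
      using that StrictImp L\<^sub>1(3) L\<^sub>2(2) by auto
    \<comment> \<open>The rule for \<open>StrictImp\<close> may be used at any \<open>w\<close>. Its
      consistent child adds either \<open>Neg A\<close>, excluding \<open>A\<close>, or
      \<open>B\<close>, excluding \<open>Neg B\<close>; in the latter case decidedness gives
      \<open>B\<close>.\<close>
    have "At A w \<notin> L\<^sub>2 \<or> At B w \<in> L\<^sub>2" if "w \<in> W" for w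
    proof -
      from L\<^sub>2(1) tableau_rule.strict_imp[of P\<^sub>2 A B L\<^sub>2 w, unfolded insert_absorb[OF principal]]
      obtain L' where "L' \<in> set [insert (At (Neg A) w) L\<^sub>2, insert (At B w) L\<^sub>2]"
        "\<not> closable (insert L\<^sub>2 P\<^sub>2) L'" by (rule unclosable_child)
      with unclosable_consistent[of "insert L\<^sub>2 P\<^sub>2" L']
      have "At A w \<notin> L\<^sub>2 \<or> At (Neg B) w \<notin> L\<^sub>2" by auto
      moreover have "decided L\<^sub>2 B w"
        using L\<^sub>2(3) that sub(2) self_in_subformulas by auto
      ultimately show ?thesis
        unfolding decided_def by blast
    qed
    then show ?thesis
      using StrictImp truth sub by auto
  next
    case (StrictNonimp A B)
    have sub: "subformulas A \<subseteq> S" "subformulas B \<subseteq> S"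
      using that StrictNonimp by (force simp: S_def)+
    have "(A, B) \<in> N"
      using that StrictNonimp by (simp add: N_def)
    then obtain v where v: "At A v \<in> L\<^sub>1" "At (Neg B) v \<in> L\<^sub>1"
      using L\<^sub>1(4) by blast
    \<comment> \<open>The witness is a world of the frame because \<open>L\<^sub>1\<close> mentions
      it; consistency with \<open>Neg B\<close> excludes \<open>B\<close>.\<close>
    then have "v \<in> W" "At A v \<in> L\<^sub>2" "At B v \<notin> L\<^sub>2"
      using L\<^sub>2(2) unclosable_consistent[OF L\<^sub>2(1)] by (auto simp: W_def mentioned_def)
    then show ?thesis
      using StrictNonimp truth sub by auto
  qed
  then have "frame (?v ` W) \<and> satisfies_set (?v ` W) \<Gamma>"
    by (auto simp: frame_def satisfies_set_def W_def)
  then show ?thesis ..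
qed

end
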